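(* For every integer $n \ge 1$, $\pi(p_{3n}) - \pi\left(\tfrac{1}{2} p_{3n}\right) > n$.
   Context: For real $x$, $\pi(x)$ denotes the number of primes not exceeding $x$, and $p_k$ denotes the $k$th prime (so $p_1 = 2$, $p_2 = 3$, …). *)

theory Defs
  imports Complex_Main "HOL-Computational_Algebra.Primes" "HOL-Library.Infinite_Set"
begin

definition primes_pi :: "real \<Rightarrow> nat" where
  "primes_pi x = card {p :: nat. prime p \<and> real p \<le> x}"

text \<open>The k-th prime, 1-indexed: nth_prime 1 = 2, nth_prime 2 = 3, ...
  Defined as the k-th element (0-indexed k-1) in increasing enumeration of the primes.\<close>
definition nth_prime :: "nat \<Rightarrow> nat" where
  "nth_prime k = enumerate {p :: nat. prime p} (k - 1)"

end

theory Submission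
  imports Defs "HOL-Number_Theory.Prime_Powers" "HOL-Analysis.Harmonic_Numbers"
begin

text \<open>
  Since \<open>\<pi>(p\<^sub>k) = k\<close>, the claim says \<open>p\<^bsub>3n\<^esub> < 2 p\<^bsub>2n\<^esub>\<close>; if this fails, then \<open>x = p\<^bsub>2n\<^esub>\<close> has \<open>\<pi>(x) = 2n\<close> and
  \<open>\<pi>(2x) < 3n\<close>. So it suffices that \<open>3 \<pi>(x) \<le> 2 \<pi>(2x)\<close> whenever \<open>\<pi>(x)\<close> is even. For \<open>7 \<le> x \<le> 14000\<close>
  monotonicity of \<open>\<pi>\<close> reduces this to finitely many values of \<open>\<pi>\<close>, computed by a sieve. For larger \<open>x\<close>,
  Chebyshev's estimates bound \<open>\<psi>(2x) - \<psi>(x)\<close>, and hence \<open>\<pi>(2x) - \<pi>(x)\<close>, from below, and \<open>\<pi>(x)\<close> from above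
  by partial summation. Chebyshev's constants differ by a factor of 6/5, whereas a factor of 4/3 would do.
\<close>

subsection \<open>Counting primes with a sieve\<close>

definition prime_count :: "nat \<Rightarrow> nat" where
  "prime_count n = card {p. prime p \<and> p \<le> n}"

lemma finite_primes_le [simp]: "finite {p :: nat. prime p \<and> p \<le> n}"
  by (rule finite_subset[of _ "{..n}"]) auto

lemma prime_count_Suc:
  "prime_count (Suc n) = (if prime (Suc n) then Suc (prime_count n) else prime_count n)"
proof -
  have "{p. prime p \<and> p \<le> Suc n} =
      (if prime (Suc n) then insert (Suc n) {p. prime p \<and> p \<le> n} else {p. prime p \<and> p \<le> n})"
    by (auto simp: le_Suc_eq)
  thus ?thesis by (simp add: prime_count_def)
qed

lemma prime_count_mono: "m \<le> n \<Longrightarrow> prime_count m \<le> prime_count n"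
  unfolding prime_count_def by (rule card_mono) auto

lemma prime_count_2: "prime_count 2 = 1"
proof -
  have "{p :: nat. prime p \<and> p \<le> 2} = {2}"
    using prime_ge_2_nat by (auto intro: antisym)
  thus ?thesis by (simp add: prime_count_def)
qed

text \<open>
  A sieve over the odd numbers whose evaluation involves no arithmetic beyond pattern
  matching on binary numerals. An entry \<open>(p, c)\<close> at the odd number \<open>n\<close> says that
  \<open>n + 2 (c - 1)\<close> is the next odd multiple of \<open>p\<close> that is at least \<open>p\<^sup>2\<close>; in particular \<open>n\<close> is
  struck iff some counter is 1.
\<close>
fun tick :: "num \<times> num \<Rightarrow> num \<times> num" where
  "tick (p, num.One) = (p, p)"
| "tick (p, num.Bit0 c) = (p, Num.BitM c)"
| "tick (p, num.Bit1 c) = (p, num.Bit0 c)"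

fun struck :: "(num \<times> num) list \<Rightarrow> bool" where
  "struck [] = False"
| "struck ((p, num.One) # l) = True"
| "struck ((p, num.Bit0 c) # l) = struck l"
| "struck ((p, num.Bit1 c) # l) = struck l"

fun sieve_step :: "num \<times> (num \<times> num) list \<Rightarrow> num \<times> (num \<times> num) list" where
  "sieve_step (a, l) = (if struck l then a else Num.inc a, map tick l)"

fun sieve_advance :: "num \<Rightarrow> num \<times> (num \<times> num) list \<Rightarrow> num \<times> (num \<times> num) list" where
  "sieve_advance num.One s = sieve_step s"
| "sieve_advance (num.Bit0 g) s = sieve_advance g (sieve_advance g s)"
| "sieve_advance (num.Bit1 g) s = sieve_advance g (sieve_advance g (sieve_step s))"

text \<open>
  \<open>sieve_emit\<close> is separate so that the simplifier can unfold the recursion only after the state has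
  been evaluated to a pair.
\<close>
fun sieve_run :: "num list \<Rightarrow> num \<times> (num \<times> num) list \<Rightarrow> num list"
  and sieve_emit :: "num list \<Rightarrow> num \<times> (num \<times> num) list \<Rightarrow> num list" where
  "sieve_run [] s = []"
| "sieve_run (g # gs) s = sieve_emit gs (sieve_advance g s)"
| "sieve_emit gs (a, l) = a # sieve_run gs (a, l)"

fun sieve_points :: "nat \<Rightarrow> num list \<Rightarrow> nat list" where
  "sieve_points n [] = []"
| "sieve_points n (g # gs) = (n + 2 * numeral g) # sieve_points (n + 2 * numeral g) gs"

section \<open>Correctness of the sieve\<close>

definition countdown :: "nat \<Rightarrow> nat \<Rightarrow> nat \<Rightarrow> bool" where
  "countdown n p c \<longleftrightarrow> odd p \<and> 3 \<le> p \<and> 0 < c \<and> p dvd n + 2 * (c - 1) \<and> p * p \<le> n + 2 * (c - 1) \<and>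
     (\<forall>i < c - 1. \<not> (p dvd n + 2 * i \<and> p * p \<le> n + 2 * i))"

lemma countdown_1_iff:
  assumes "countdown n p c"
  shows "c = 1 \<longleftrightarrow> p dvd n \<and> p * p \<le> n"
proof (cases "c = 1")
  case True
  thus ?thesis using assms by (simp add: countdown_def)
next
  case False
  hence "0 < c - 1" using assms by (auto simp: countdown_def)
  thus ?thesis using assms False unfolding countdown_def by fastforce
qed

text \<open>At 3 the first number to strike is p^2 itself: 3 + 2 (c - 1) = p^2 gives c = (p^2 - 1) /
  2.\<close>

lemma countdown_init:
  assumes "odd p" "3 \<le> p"
  shows "countdown 3 p ((p * p - 1) div 2)"
proof -
  have pp: "p * p \<ge> 9" using mult_le_mono[OF assms(2) assms(2)] by simp
  have "odd (p * p)" using assms by simp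
  then obtain k where k: "p * p = 2 * k + 1" by (elim oddE)
  with pp have kk: "(p * p - 1) div 2 = k" "k \<ge> 4" by auto
  have eq: "3 + 2 * (k - 1) = p * p" using k kk by simp
  have "\<not> p * p \<le> 3 + 2 * i" if "i < k - 1" for i using that k kk by simp
  thus ?thesis using assms kk(2) eq unfolding countdown_def kk(1) by simp
qed

lemma countdown_next:
  assumes "countdown n p c"
  shows "countdown (n + 2) p (if c = 1 then p else c - 1)"
proof (cases "c = 1")
  case True
  have p: "odd p" "3 \<le> p" "p dvd n" "p * p \<le> n"
    using assms True by (auto simp: countdown_def)
  have eq: "n + 2 + 2 * (p - 1) = n + 2 * p" using p(2) by simp
  \<comment> \<open>Consecutive odd multiples of p differ by 2p, so the counter restarts at p; the
    factor 2 cancels because p is odd.\<close>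
  have "\<not> p dvd n + 2 + 2 * i" if "i < p - 1" for i
  proof
    assume "p dvd n + 2 + 2 * i"
    hence "p dvd n + 2 * (i + 1)" by (simp add: algebra_simps)
    hence "p dvd 2 * (i + 1)" using p(3) by (simp only: dvd_add_right_iff)
    moreover have "coprime p 2" using p(1) by simp
    ultimately have "p dvd i + 1" by (simp only: coprime_dvd_mult_right_iff)
    thus False using that by (auto dest: dvd_imp_le)
  qed
  moreover have "p dvd n + 2 + 2 * (p - 1)" unfolding eq using p(3) by simp
  ultimately show ?thesis using p True by (simp add: countdown_def)
next
  case False
  hence c: "2 \<le> c" using assms by (auto simp: countdown_def)
  have eq: "n + 2 + 2 * (c - 1 - 1) = n + 2 * (c - 1)" using c by simp
  have "\<not> (p dvd n + 2 + 2 * i \<and> p * p \<le> n + 2 + 2 * i)" if "i < c - 1 - 1" for i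
  proof -
    have "i + 1 < c - 1" using that by simp
    moreover have "n + 2 * (i + 1) = n + 2 + 2 * i" by simp
    ultimately show ?thesis using assms unfolding countdown_def by metis
  qed
  moreover have "0 < c - 1" using c by simp
  ultimately show ?thesis
    using assms False unfolding countdown_def eq if_not_P[OF False] by blast
qed

definition counter_ok :: "nat \<Rightarrow> num \<times> num \<Rightarrow> bool" where
  "counter_ok n x = countdown n (numeral (fst x)) (numeral (snd x))"

lemma fst_tick: "fst (tick x) = fst x"
  by (cases x rule: tick.cases) auto

lemma numeral_snd_tick:
  "(numeral (snd (tick x)) :: nat) =
     (if numeral (snd x) = (1 :: nat) then numeral (fst x) else numeral (snd x) - 1)"
  by (cases x rule: tick.cases) simp_all

lemma counter_ok_tick: "counter_ok n x \<Longrightarrow> counter_ok (n + 2) (tick x)"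
  using countdown_next by (simp only: counter_ok_def fst_tick numeral_snd_tick)

lemma not_prime_imp_small_divisor:
  fixes n :: nat
  assumes "n > 1" "\<not> prime n"
  obtains q where "prime q" "q dvd n" "q * q \<le> n"
proof -
  obtain a b where ab: "n = a * b" "a \<noteq> 1" "b \<noteq> 1"
    using assms by (auto simp: prime_nat_iff elim!: dvdE)
  define m where "m = min a b"
  have m: "m dvd n" "m \<noteq> 1" "m * m \<le> n"
    using ab by (auto simp: m_def min_def intro: mult_le_mono)
  obtain q where q: "prime q" "q dvd m" using prime_factor_nat[OF m(2)] by blast
  have "m > 0" using m(1) assms by (auto intro!: Nat.gr0I)
  hence "q \<le> m" using q by (intro dvd_imp_le)
  hence "q * q \<le> n" using mult_le_mono[of q m q m] m(3) by linarith
  thus ?thesis using that[of q] q m by (meson dvd_trans)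
qed

text \<open>Loop invariant after all numbers up to the even n are counted, so the counters refer to
  n + 1. An odd composite up to \<open>B\<close> has an odd prime factor q with q * q \<le> B, so by
  the last clause the list can detect it.\<close>

definition sieve_ok :: "nat \<Rightarrow> nat \<Rightarrow> num \<times> (num \<times> num) list \<Rightarrow> bool" where
  "sieve_ok B n = (\<lambda>(a, l). even n \<and> 2 \<le> n \<and> prime_count n = numeral a \<and>
     (\<forall>x \<in> set l. counter_ok (n + 1) x) \<and>
     (\<forall>q. prime q \<and> odd q \<and> q * q \<le> B \<longrightarrow> (\<exists>x \<in> set l. numeral (fst x) = q)))"

lemma struck_iff: "struck l \<longleftrightarrow> (\<exists>x \<in> set l. snd x = num.One)"
  by (induction l rule: struck.induct) auto

text \<open>Strikes begin at p^2, so a struck number is a proper multiple of p. An unstruck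
  composite n + 1 would have a prime factor q with q * q \<le> n + 1 \<le> B, whose counter would be
  1.\<close>

lemma sieve_ok_step:
  assumes ok: "sieve_ok B n s" and B: "n + 1 \<le> B"
  shows "sieve_ok B (n + 2) (sieve_step s)"
proof -
  obtain a l where s: "s = (a, l)" by force
  have n: "even n" "2 \<le> n" "prime_count n = numeral a"
    and l: "\<And>x. x \<in> set l \<Longrightarrow> counter_ok (n + 1) x"
    and complete: "\<And>q. prime q \<Longrightarrow> odd q \<Longrightarrow> q * q \<le> B \<Longrightarrow> \<exists>x \<in> set l. numeral (fst x) = q"
    using ok by (auto simp: sieve_ok_def s)
  have strikes: "snd x = num.One \<longleftrightarrow>
      (numeral (fst x) :: nat) dvd n + 1 \<and> numeral (fst x) * numeral (fst x) \<le> n + 1"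
    if "x \<in> set l" for x
    using countdown_1_iff[OF l[OF that, unfolded counter_ok_def]] by (simp only: numeral_eq_one_iff)
  have prime_iff: "prime (n + 1) \<longleftrightarrow> \<not> struck l"
  proof
    assume pr: "prime (n + 1)"
    show "\<not> struck l"
    proof
      assume "struck l"
      then obtain x where x: "x \<in> set l" "snd x = num.One" by (auto simp: struck_iff)
      define P where "P = (numeral (fst x) :: nat)"
      have "P dvd n + 1" "P * P \<le> n + 1" using strikes[OF x(1)] x(2) by (auto simp: P_def)
      moreover have "P \<ge> 3" using l[OF x(1)] by (simp only: counter_ok_def countdown_def P_def)
      ultimately have "P = n + 1" using pr by (auto simp: prime_nat_iff)
      with \<open>P * P \<le> n + 1\<close> \<open>P \<ge> 3\<close> show False by (simp del: mult_Suc mult_Suc_right)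
    qed
  next
    assume ns: "\<not> struck l"
    show "prime (n + 1)"
    proof (rule ccontr)
      assume "\<not> prime (n + 1)"
      then obtain q where q: "prime q" "q dvd n + 1" "q * q \<le> n + 1"
        using not_prime_imp_small_divisor[of "n + 1"] n(2) by auto
      have "odd q" using q(2) n(1) by (meson dvd_trans even_plus_one_iff)
      then obtain x where "x \<in> set l" "numeral (fst x) = q"
        using complete[of q] q B by auto
      thus False using strikes[of x] q ns by (auto simp: struck_iff)
    qed
  qed
  have "\<not> prime (n + 2)"
    using n prime_odd_nat[of "n + 2"] by auto
  hence "prime_count (n + 2) = (if struck l then prime_count n else Suc (prime_count n))"
    using prime_iff prime_count_Suc[of n] prime_count_Suc[of "n + 1"] by simp
  moreover have "counter_ok (n + 2 + 1) (tick x)" if "x \<in> set l" for x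
    using counter_ok_tick[OF l[OF that]] by (simp add: add_ac)
  ultimately show ?thesis
    using n complete by (auto simp: s sieve_ok_def numeral_inc fst_tick)
qed

text \<open>The last odd number tested is n + 2g - 1, which is why the end point may reach
  \<open>B + 1\<close>.\<close>

lemma sieve_ok_advance:
  "sieve_ok B n s \<Longrightarrow> n + 2 * numeral g \<le> B + 1 \<Longrightarrow> sieve_ok B (n + 2 * numeral g) (sieve_advance g s)"
proof (induction g arbitrary: n s)
  case One
  thus ?case using sieve_ok_step[of B n s] by simp
next
  case (Bit0 g)
  define k :: nat where "k = numeral g"
  have "n + 2 * k + 2 * k \<le> B + 1" using Bit0.prems(2)
    unfolding numeral_Bit0 k_def[symmetric] by simp
  hence "sieve_ok B (n + 2 * k + 2 * k) (sieve_advance g (sieve_advance g s))"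
    unfolding k_def by (intro Bit0.IH Bit0.prems(1)) linarith+
  moreover have "n + 2 * numeral (num.Bit0 g) = n + 2 * k + 2 * k"
    unfolding numeral_Bit0 k_def[symmetric] by simp
  ultimately show ?case by (simp only: sieve_advance.simps)
next
  case (Bit1 g)
  define k :: nat where "k = numeral g"
  have "n + 2 + 2 * k + 2 * k \<le> B + 1" using Bit1.prems(2)
    unfolding numeral_Bit1 k_def[symmetric] by simp
  hence "sieve_ok B (n + 2 + 2 * k + 2 * k) (sieve_advance g (sieve_advance g (sieve_step s)))"
    unfolding k_def by (intro Bit1.IH sieve_ok_step Bit1.prems(1)) linarith+
  moreover have "n + 2 * numeral (num.Bit1 g) = n + 2 + 2 * k + 2 * k"
    unfolding numeral_Bit1 k_def[symmetric] by simp
  ultimately show ?case by (simp only: sieve_advance.simps)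
qed

lemma sieve_ok_run:
  "sieve_ok B n s \<Longrightarrow> \<forall>m \<in> set (sieve_points n gs). m \<le> B + 1 \<Longrightarrow>
     map prime_count (sieve_points n gs) = map numeral (sieve_run gs s)"
proof (induction gs arbitrary: n s)
  case (Cons g gs)
  obtain a l where al: "sieve_advance g s = (a, l)" by force
  have "sieve_ok B (n + 2 * numeral g) (a, l)"
    using sieve_ok_advance[of B n s g] Cons.prems al by simp
  moreover from this have "prime_count (n + 2 * numeral g) = numeral a"
    by (simp add: sieve_ok_def)
  ultimately show ?case using Cons al by simp
qed simp

definition sieve_init :: "nat list \<Rightarrow> num \<times> (num \<times> num) list" where
  "sieve_init ps = (num.One, map (\<lambda>p. (num_of_nat p, num_of_nat ((p * p - 1) div 2))) ps)"

lemma counter_ok_init: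
  assumes "odd p" "3 \<le> p"
  shows "counter_ok 3 (num_of_nat p, num_of_nat ((p * p - 1) div 2))"
proof -
  have "countdown 3 p ((p * p - 1) div 2)" using assms by (rule countdown_init)
  moreover from this have "0 < (p * p - 1) div 2" by (simp only: countdown_def)
  ultimately show ?thesis
    using assms by (simp only: counter_ok_def fst_conv snd_conv numeral_num_of_nat)
qed

lemma sieve_ok_init:
  assumes "\<And>p. p \<in> set ps \<Longrightarrow> odd p \<and> 3 \<le> p"
    and "\<And>q. prime q \<Longrightarrow> odd q \<Longrightarrow> q * q \<le> B \<Longrightarrow> q \<in> set ps"
  shows "sieve_ok B 2 (sieve_init ps)"
proof -
  have "\<forall>q. prime q \<and> odd q \<and> q * q \<le> B \<longrightarrow> (\<exists>x \<in> set ps. numeral (num_of_nat x) = q)"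
  proof (intro allI impI)
    fix q assume "prime q \<and> odd q \<and> q * q \<le> B"
    thus "\<exists>x \<in> set ps. numeral (num_of_nat x) = q"
      using assms(2)[of q] by (intro bexI[of _ q]) (auto simp: numeral_num_of_nat prime_gt_0_nat)
  qed
  thus ?thesis
    using assms(1) counter_ok_init by (force simp: sieve_ok_def sieve_init_def prime_count_2)
qed

section \<open>Table of prime counts and the doubling inequality up to 14000\<close>

text \<open>All odd primes below 149; the table ends at 22110, which is less than \<open>149\<^sup>2\<close>.\<close>
definition sieving_primes :: "nat list" where
  "sieving_primes = [3, 5, 7, 11, 13, 17, 19, 23, 29, 31, 37, 41, 43, 47, 53, 59, 61, 67, 71, 73,
     79, 83, 89, 97, 101, 103, 107, 109, 113, 127, 131, 137, 139]"

text \<open>Half the distances between the successive points, from 2 on, at which \<pi> is recorded.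
  The points include b and 2a for every interval (a, b) in
  \<open>prime_count_doubling_table\<close>, and 540, where the partial summation starts.\<close>

definition table_gaps :: "nat list" where
  "table_gaps = [1, 1, 1, 1, 1, 1, 1, 1, 1, 1, 1, 3, 1, 2, 1, 3, 2, 3, 3, 4, 3, 4, 4, 4, 6, 3, 11, 1,
     12, 6, 11, 9, 9, 14, 10, 19, 17, 20, 19, 27, 19, 8, 30, 21, 49, 24, 64, 28, 77, 38, 107, 33,
     141, 34, 186, 24, 245, 46, 312, 35, 408, 33, 530, 7, 705, 12, 886, 17, 1108, 57, 1368, 105,
     1725, 2330]"

text \<open>149^2 = 22201 exceeds the bound, and a composite below 149 < 13^2 has a prime factor at
  most 11.\<close>

lemma sieving_primes_complete:
  assumes "prime q" "odd q" "q * q \<le> 22200"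
  shows "q \<in> set sieving_primes"
proof -
  have "q < 149"
  proof (rule ccontr)
    assume "\<not> q < 149"
    hence "149 * 149 \<le> q * q" by (intro mult_le_mono) auto
    thus False using assms by simp
  qed
  moreover have "list_all (\<lambda>q. q \<in> set sieving_primes \<or> list_ex (\<lambda>d. d dvd q \<and> d \<noteq> q) [2, 3, 5, 7, 11])
      [3..<149]"
    by (simp add: sieving_primes_def upt_rec_numeral)
  moreover have "q \<ge> 3" using prime_ge_2_nat[OF assms(1)] assms(2) by (cases "q = 2") auto
  ultimately have "q \<in> set sieving_primes \<or> list_ex (\<lambda>d. d dvd q \<and> d \<noteq> q) [2, 3, 5, 7, 11]"
    unfolding list_all_iff set_upt by simp
  thus ?thesis using assms(1) by (auto simp: prime_nat_iff)
qed

lemma sieve_points_gaps: "sieve_points 2 (map num_of_nat table_gaps) =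
  [4, 6, 8, 10, 12, 14, 16, 18, 20, 22, 24, 30, 32, 36, 38, 44, 48, 54, 60, 68, 74, 82, 90, 98,
   110, 116, 138, 140, 164, 176, 198, 216, 234, 262, 282, 320, 354, 394, 432, 486, 524, 540, 600,
   642, 740, 788, 916, 972, 1126, 1202, 1416, 1482, 1764, 1832, 2204, 2252, 2742, 2834, 3458, 3528,
   4344, 4410, 5470, 5484, 6894, 6918, 8690, 8724, 10940, 11054, 13790, 14000, 17450, 22110]"
  by (simp add: table_gaps_def num_of_nat_numeral_eq)

lemma sieve_run_gaps: "map numeral (sieve_run (map num_of_nat table_gaps) (sieve_init sieving_primes)) =
  [2, 3, 4, 4, 5, 6, 6, 7, 8, 8, 9, 10, 11, 11, 12, 14, 15, 16, 17, 19, 21, 22, 24, 25, 29, 30,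
   33, 34, 38, 40, 45, 47, 51, 55, 60, 66, 71, 77, 83, 92, 99, 99, 109, 116, 131, 138, 156, 164,
   188, 197, 223, 234, 274, 282, 328, 335, 400, 411, 483, 492, 593, 600, 721, 725, 886, 890, 1082,
   1087, 1329, 1338, 1631, 1652, 2007, 2478 :: nat]"
  \<comment> \<open>Arithmetic is used only to evaluate the gaps and the initial state; the run
    itself is pure constructor rewriting.\<close>
  by (simp add: table_gaps_def sieving_primes_def sieve_init_def num_of_nat_numeral_eq del: sieve_run.simps)
     (simp only: sieve_run.simps sieve_emit.simps sieve_advance.simps sieve_step.simps struck.simps tick.simps list.map
       Num.BitM.simps Num.inc.simps if_True if_False)

lemma prime_count_points:
  "map prime_count (sieve_points 2 (map num_of_nat table_gaps)) =
   map numeral (sieve_run (map num_of_nat table_gaps) (sieve_init sieving_primes))"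
proof (rule sieve_ok_run[OF sieve_ok_init])
  show "\<And>p. p \<in> set sieving_primes \<Longrightarrow> odd p \<and> 3 \<le> p"
    by (auto simp: sieving_primes_def)
  show "\<forall>m \<in> set (sieve_points 2 (map num_of_nat table_gaps)). m \<le> 22200 + 1"
    unfolding sieve_points_gaps by simp
qed (rule sieving_primes_complete)

lemmas prime_count_values =
  prime_count_points[unfolded sieve_points_gaps sieve_run_gaps, unfolded list.map list.inject]

lemma prime_count_doubling_table:
  fixes x :: nat
  assumes "7 \<le> x" "x \<le> 14000"
  shows "3 * prime_count x \<le> 2 * prime_count (2 * x)"
proof -
  have interval: "3 * prime_count x \<le> 2 * prime_count (2 * x)"
    if "3 * prime_count b \<le> 2 * prime_count (2 * a)" "a \<le> x" "x \<le> b" for a b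
    using that prime_count_mono[of x b] prime_count_mono[of "2 * a" "2 * x"] by linarith
  \<comment> \<open>These intervals cover all integers from 7 to 14000. Every b is even, so both b
    and 2a can be points of the table.\<close>
  define bs :: "(nat \<times> nat) list" where
    "bs = [(7, 10), (10, 12), (12, 16), (16, 18), (19, 22), (22, 24), (24, 30), (30, 36), (37, 44),
      (45, 54), (55, 68), (69, 82), (82, 98), (99, 116), (117, 140), (141, 176), (177, 216), (216,
      262), (262, 320), (321, 394), (394, 486), (486, 600), (601, 740), (741, 916), (916, 1126),
      (1126, 1416), (1417, 1764), (1764, 2204), (2205, 2742), (2742, 3458), (3459, 4344), (4345,
      5470), (5470, 6894), (6895, 8724), (8725, 11054), (11055, 14000)]"
  have "\<exists>(a, b) \<in> set bs. a \<le> x \<and> x \<le> b"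
    using assms unfolding bs_def by simp presburger
  moreover have "\<forall>(a, b) \<in> set bs. 3 * prime_count b \<le> 2 * prime_count (2 * a)"
    unfolding bs_def by (simp add: prime_count_values)
  ultimately show ?thesis using interval by blast
qed

subsection \<open>Chebyshev's estimates\<close>

definition psi :: "nat \<Rightarrow> real" where
  "psi n = (\<Sum>d=1..n. mangoldt d)"

lemma psi_mono: "m \<le> n \<Longrightarrow> psi m \<le> psi n"
  unfolding psi_def by (rule sum_mono2) (auto intro: mangoldt_nonneg)

lemma psi_Suc: "psi (Suc n) = psi n + mangoldt (Suc n)"
  by (simp add: psi_def)

lemma psi_diff: "m \<le> n \<Longrightarrow> psi n - psi m = (\<Sum>d\<in>{m<..n}. mangoldt d)"
  unfolding psi_def by (subst sum_diff[symmetric]) (auto intro: sum.cong)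

text \<open>The numbers 1, ..., n are among the divisors of M, over which \<open>mangoldt\<close>
  sums to ln M.\<close>

lemma psi_le_ln:
  assumes "M > 0" "\<And>d. d \<in> {1..n} \<Longrightarrow> d dvd M"
  shows "psi n \<le> ln (real M)"
proof -
  have "psi n \<le> (\<Sum>d | d dvd M. mangoldt d)"
    unfolding psi_def using assms by (intro sum_mono2) (auto intro: mangoldt_nonneg)
  also have "\<dots> = ln (real M)" using assms(1) mangoldt_sum[of M, where ?'a = real] by simp
  finally show ?thesis .
qed

text \<open>Legendre's formula. The common range up to N, where terms with d > n vanish, lets
  several factorials be combined termwise.\<close>

lemma ln_fact_eq_sum_mangoldt:
  "n \<le> N \<Longrightarrow> ln (fact n) = (\<Sum>d=1..N. mangoldt d * real (n div d))"
proof (induction n)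
  case (Suc n)
  have "ln (real (Suc n)) = (\<Sum>d | d dvd Suc n. mangoldt d)"
    using mangoldt_sum[of "Suc n", where ?'a = real] by simp
  also have "\<dots> = (\<Sum>d=1..N. if d dvd Suc n then mangoldt d else 0)"
  proof (intro sum.mono_neutral_cong_left)
    show "{d. d dvd Suc n} \<subseteq> {1..N}"
    proof
      fix d assume "d \<in> {d. d dvd Suc n}"
      moreover from this have "d \<le> Suc n" by (auto intro: dvd_imp_le)
      ultimately show "d \<in> {1..N}" using Suc.prems by (auto simp: Suc_le_eq intro!: Nat.gr0I)
    qed
  qed auto
  finally have ln: "ln (real (Suc n)) = (\<Sum>d=1..N. if d dvd Suc n then mangoldt d else 0)" .
  have "ln (fact (Suc n)) = ln (real (Suc n)) + ln (fact n :: real)"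
    by (simp add: ln_mult del: of_nat_Suc)
  also have "\<dots> = (\<Sum>d=1..N. if d dvd Suc n then mangoldt d else 0)
      + (\<Sum>d=1..N. mangoldt d * real (n div d))"
    unfolding ln using Suc by simp
  also have "\<dots> = (\<Sum>d=1..N. (if d dvd Suc n then mangoldt d else 0) + mangoldt d * real (n div d))"
    by (simp only: sum.distrib)
  also have "\<dots> = (\<Sum>d=1..N. mangoldt d * real (Suc n div d))"
    by (intro sum.cong) (auto simp: div_Suc dvd_eq_mod_eq_0 algebra_simps)
  finally show ?case .
qed simp

text \<open>As 1 + 1/30 = 1/2 + 1/3 + 1/5, the difference of the two sides has period 30 in q, and
  checking the residues shows that it is 0 or 1.\<close>

lemma chebyshev_weight:
  fixes q :: nat
  shows "q div 2 + q div 3 + q div 5 \<le> q + q div 30"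
    and "q + q div 30 \<le> q div 2 + q div 3 + q div 5 + 1"
    and "1 \<le> q \<Longrightarrow> q < 6 \<Longrightarrow> q + q div 30 = q div 2 + q div 3 + q div 5 + 1"
proof -
  define k r where "k = q div 30" and "r = q mod 30"
  have q: "q = 30 * k + r" and r: "r < 30" by (simp_all add: k_def r_def)
  have eq: "q div 2 = 15 * k + r div 2" "q div 3 = 10 * k + r div 3" "q div 5 = 6 * k + r div 5"
    "q div 30 = k"
    using r by (simp_all add: q)
  have "r \<in> set [0..<30]" using r by simp
  hence "r div 2 + r div 3 + r div 5 \<le> r \<and> r \<le> r div 2 + r div 3 + r div 5 + 1"
    by (simp add: upt_rec) (elim disjE; simp)
  thus "q div 2 + q div 3 + q div 5 \<le> q + q div 30"
    and "q + q div 30 \<le> q div 2 + q div 3 + q div 5 + 1"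
    unfolding eq by (simp_all add: q)
  assume "1 \<le> q" "q < 6"
  hence "q \<in> {1, 2, 3, 4, 5}" by auto
  thus "q + q div 30 = q div 2 + q div 3 + q div 5 + 1" by auto
qed

text \<open>
  Chebyshev's integer \<open>(30m)! m! / ((15m)! (10m)! (6m)!)\<close>. Restricting to multiples of 30 avoids floors
  in Stirling's formula.
\<close>
definition chebyshev_log :: "nat \<Rightarrow> real" where
  "chebyshev_log m = ln (fact (30 * m)) + ln (fact m)
     - ln (fact (15 * m)) - ln (fact (10 * m)) - ln (fact (6 * m))"

lemma div_eq_div_div: "c > 0 \<Longrightarrow> a div d = c * a div d div c" for a c d :: nat
  by (metis div_mult2_eq div_mult_mult1 mult.commute neq0_conv)

lemma chebyshev_log_eq:
  defines "w \<equiv> \<lambda>q :: nat. real (q + q div 30) - real (q div 2 + q div 3 + q div 5)"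
  shows "chebyshev_log m = (\<Sum>d=1..30*m. mangoldt d * w (30 * m div d))"
proof -
  have "15 * m div d = 30 * m div d div 2" "10 * m div d = 30 * m div d div 3"
    "6 * m div d = 30 * m div d div 5" "m div d = 30 * m div d div 30" for d
    using div_eq_div_div[of 2 "15 * m" d] div_eq_div_div[of 3 "10 * m" d]
      div_eq_div_div[of 5 "6 * m" d] div_eq_div_div[of 30 m d] by simp_all
  thus ?thesis
    unfolding chebyshev_log_def w_def
    by (simp add: ln_fact_eq_sum_mangoldt[where N = "30 * m"] algebra_simps
        flip: sum.distrib sum_subtractf)
qed

lemma chebyshev_log_le_psi: "chebyshev_log m \<le> psi (30 * m)"
  unfolding chebyshev_log_eq psi_def
proof (rule sum_mono)
  fix d
  have "real (30 * m div d + 30 * m div d div 30) - real (30 * m div d div 2 +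
      30 * m div d div 3 + 30 * m div d div 5) \<le> 1"
    using chebyshev_weight(2)[of "30 * m div d"] by linarith
  from mult_left_mono[OF this mangoldt_nonneg[of d]]
  show "mangoldt d * (real (30 * m div d + 30 * m div d div 30) - real (30 * m div d div 2 +
      30 * m div d div 3 + 30 * m div d div 5)) \<le> mangoldt d" by simp
qed

text \<open>For 5m < d \<le> 30m the quotient 30m div d lies between 1 and 5, where the weight is 1;
  elsewhere it is nonnegative.\<close>

lemma psi_le_chebyshev_log: "psi (30 * m) \<le> psi (5 * m) + chebyshev_log m"
proof -
  have "psi (30 * m) - psi (5 * m) = (\<Sum>d\<in>{5*m<..30*m}. mangoldt d)"
    by (rule psi_diff) simp
  also have "\<dots> = (\<Sum>d=1..30*m. if 5 * m < d then mangoldt d else 0)"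
    by (intro sum.mono_neutral_cong_left) auto
  also have "\<dots> \<le> chebyshev_log m"
    unfolding chebyshev_log_eq
  proof (rule sum_mono)
    fix d assume d: "d \<in> {1..30*m}"
    define q where "q = 30 * m div d"
    have "real (q div 2 + q div 3 + q div 5) \<le> real (q + q div 30)"
      using chebyshev_weight(1)[of q] by (simp only: of_nat_le_iff)
    moreover have "real (q + q div 30) - real (q div 2 + q div 3 + q div 5) = 1" if "5 * m < d"
    proof -
      have "q < 6" using that d by (simp add: q_def div_less_iff_less_mult)
      moreover have "1 \<le> q" using d by (auto simp: q_def Suc_le_eq div_greater_zero_iff)
      ultimately show ?thesis using chebyshev_weight(3)[of q] by linarith
    qed
    ultimately show "(if 5 * m < d then mangoldt d else 0)
        \<le> mangoldt d * (real (30 * m div d + 30 * m div d div 30) - real (30 * m div d div 2 +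
            30 * m div d div 3 + 30 * m div d div 5))"
      using mangoldt_nonneg[of d] unfolding q_def[symmetric] by auto
  qed
  finally show ?thesis by simp
qed

section \<open>Stirling's formula with explicit error, and numerical logarithms\<close>

text \<open>The logarithm of n! / (n^(n + 1/2) e^(-n)), which decreases from 1 to ln (2 \<pi>) /
  2.\<close>

definition stirling_err :: "nat \<Rightarrow> real" where
  "stirling_err n = ln (fact n) - (real n + 1/2) * ln (real n) + real n"

lemma stirling_err_Suc:
  assumes "n > 0"
  shows "stirling_err (Suc n) = stirling_err n + 1 - (real n + 1/2) * (ln (real n + 1) - ln (real n))"
proof -
  have "ln (fact (Suc n)) = ln (real (Suc n)) + ln (fact n :: real)"
    by (simp add: ln_mult del: of_nat_Suc)
  thus ?thesis unfolding stirling_err_def by (simp add: algebra_simps add_divide_distrib)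
qed

text \<open>By convexity of 1/x, the midpoint rule shows that \<open>stirling_err n\<close>
  decreases and the trapezoidal rule that \<open>stirling_err n\<close> - 1/(4n) increases; at n = 1
  their values are 1 and 3/4.\<close>

lemma stirling_err_bounds:
  assumes "n > 0"
  shows "stirling_err n \<le> 1" "3/4 + 1 / (4 * real n) \<le> stirling_err n"
proof -
  have "stirling_err n \<le> 1 \<and> 3/4 + 1 / (4 * real n) \<le> stirling_err n"
    using assms
  proof (induction n rule: nat_induct_non_zero)
    case 1
    thus ?case by (simp add: stirling_err_def)
  next
    case (Suc n)
    define D where "D = ln (real n + 1) - ln (real n)"
    have "2 / (2 * real n + 1) \<le> D"
      using ln_inverse_approx_ge[of "real n" "real n + 1"] Suc.hyps by (simp add: D_def add_ac)
    hence lower: "1 \<le> (real n + 1/2) * D"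
      by (simp add: field_simps)
    have "D \<le> (1 / real n + 1 / (real n + 1)) / 2"
      using ln_inverse_approx_le[of "real n" 1] Suc.hyps by (simp add: D_def field_simps)
    hence "(real n + 1/2) * D \<le> (real n + 1/2) * ((1 / real n + 1 / (real n + 1)) / 2)"
      by (intro mult_left_mono) auto
    also have "(x + 1/2) * ((1 / x + 1 / (x + 1)) / 2) = 1 + 1 / (4 * x) - 1 / (4 * (x + 1))"
      if "x > 0" for x :: real
      using that by (simp add: divide_simps) (simp add: algebra_simps)
    from this[of "real n"] have "(real n + 1/2) * ((1 / real n + 1 / (real n + 1)) / 2) =
        1 + 1 / (4 * real n) - 1 / (4 * real (Suc n))" using Suc.hyps by (simp add: add_ac)
    finally show ?case
      using lower Suc.IH Suc.hyps by (simp add: stirling_err_Suc D_def[symmetric])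
  qed
  thus "stirling_err n \<le> 1" "3/4 + 1 / (4 * real n) \<le> stirling_err n" by auto
qed

lemma ln_2_bounds: "69314/100000 \<le> ln (2::real)" "ln (2::real) \<le> 69315/100000"
  using ln_approx_bounds[of 2 6] by (simp_all add: eval_nat_numeral)

lemma ln_3_bounds: "109860/100000 \<le> ln (3::real)" "ln (3::real) \<le> 109862/100000"
proof -
  have "ln (3::real) = ln (3/2) + ln 2" by (simp add: ln_div)
  moreover have "40546/100000 \<le> ln (3/2::real)" "ln (3/2::real) \<le> 40547/100000"
    using ln_approx_bounds[of "3/2" 4] by (simp_all add: eval_nat_numeral)
  ultimately show "109860/100000 \<le> ln (3::real)" "ln (3::real) \<le> 109862/100000"
    using ln_2_bounds by linarith+
qed

lemma ln_5_bounds: "160942/100000 \<le> ln (5::real)" "ln (5::real) \<le> 160945/100000"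
proof -
  have "ln (5/4::real) = ln 5 - ln (2 ^ 2)" by (simp add: ln_div)
  hence "ln (5::real) = ln (5/4) + 2 * ln 2" by (subst (asm) ln_realpow) auto
  moreover have "22314/100000 \<le> ln (5/4::real)" "ln (5/4::real) \<le> 22315/100000"
    using ln_approx_bounds[of "5/4" 3] by (simp_all add: eval_nat_numeral)
  ultimately show "160942/100000 \<le> ln (5::real)" "ln (5::real) \<le> 160945/100000"
    using ln_2_bounds by linarith+
qed

text \<open>Since 30 + 1 = 15 + 10 + 6, the terms m ln m and the linear terms of Stirling's formula
  cancel. The remaining coefficient of m is 30 times Chebyshev's constant 0.92129...\<close>

lemma chebyshev_log_stirling:
  assumes "m > 0"
  shows "chebyshev_log m = (14 * ln 2 + 9 * ln 3 + 5 * ln 5) * real m - ln (30 * real m) / 2 +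
    stirling_err (30 * m) + stirling_err m
    - stirling_err (15 * m) - stirling_err (10 * m) - stirling_err (6 * m)"
proof -
  have ln_fact: "ln (fact n) = (real n + 1/2) * ln (real n) - real n + stirling_err n" for n
    by (simp add: stirling_err_def)
  have "ln (30::real) = ln (2 * 3 * 5)" "ln (15::real) = ln (3 * 5)" "ln (10::real) = ln (2 * 5)"
    "ln (6::real) = ln (2 * 3)" by simp_all
  hence ln: "ln (30::real) = ln 2 + ln 3 + ln 5" "ln (15::real) = ln 3 + ln 5"
    "ln (10::real) = ln 2 + ln 5" "ln (6::real) = ln 2 + ln 3"
    by (simp_all only: ln_mult) simp_all
  show ?thesis
    using assms unfolding chebyshev_log_def ln_fact
    by (simp add: ln_mult ln algebra_simps add_divide_distrib)
qed

text \<open>The Stirling errors add up to at most 1 + 1 - 3 * 3/4 < 0, so no additive constant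
  remains.\<close>

lemma chebyshev_log_upper: "chebyshev_log m \<le> 2764/100 * real m"
proof (cases "m = 0")
  case False
  have "14 * ln 2 + 9 * ln 3 + 5 * ln 5 \<le> (2764/100 :: real)"
    using ln_2_bounds ln_3_bounds ln_5_bounds by linarith
  from mult_right_mono[OF this, of "real m"]
  have "(14 * ln 2 + 9 * ln 3 + 5 * ln 5) * real m \<le> 2764/100 * real m" by simp
  moreover have "0 \<le> ln (30 * real m)" using False by simp
  moreover have "3/4 \<le> stirling_err n" if "n > 0" for n
    using stirling_err_bounds(2)[OF that] by (smt (verit) divide_nonneg_nonneg of_nat_0_le_iff)
  from this[of "15 * m"] this[of "10 * m"] this[of "6 * m"]
  have "3/4 \<le> stirling_err (15 * m)" "3/4 \<le> stirling_err (10 * m)" "3/4 \<le> stirling_err (6 * m)"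
    using False by auto
  moreover have "stirling_err (30 * m) \<le> 1" "stirling_err m \<le> 1"
    using stirling_err_bounds(1) False by auto
  ultimately show ?thesis
    using chebyshev_log_stirling[of m] False by linarith
qed (simp add: chebyshev_log_def)

lemma chebyshev_log_lower:
  assumes "m > 0"
  shows "27638/1000 * real m - ln (30 * real m) / 2 - 3/2 \<le> chebyshev_log m"
proof -
  have "27638/1000 \<le> 14 * ln 2 + 9 * ln 3 + 5 * ln (5 :: real)"
    using ln_2_bounds ln_3_bounds ln_5_bounds by linarith
  from mult_right_mono[OF this, of "real m"]
  have "27638/1000 * real m \<le> (14 * ln 2 + 9 * ln 3 + 5 * ln 5) * real m" by simp
  moreover have "3/4 \<le> stirling_err n" if "n > 0" for n
    using stirling_err_bounds(2)[OF that] by (smt (verit) divide_nonneg_nonneg of_nat_0_le_iff)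
  from this[of "30 * m"] this[of m]
  have "3/4 \<le> stirling_err (30 * m)" "3/4 \<le> stirling_err m"
    using assms by auto
  moreover have "stirling_err (15 * m) \<le> 1" "stirling_err (10 * m) \<le> 1" "stirling_err (6 * m) \<le> 1"
    using stirling_err_bounds(1) assms by auto
  ultimately show ?thesis
    using chebyshev_log_stirling[of m] assms by linarith
qed

section \<open>Explicit bounds for \<open>psi\<close>\<close>

text \<open>
  With \<open>m = \<lceil>x / 30\<rceil>\<close> we have \<open>5m - 29/5 \<le> (x - 29/5) / 6\<close>, so each recursion step lowers the logarithm by
  at least \<open>ln 6\<close>, and 18 of these pay for the rounding error \<open>29 * 1.1056\<close> of the step.
\<close>
lemma psi_upper_log:
  "10 \<le> x \<Longrightarrow> psi x \<le> 11056/10000 * real x + 18 * ln (real x - 29/5) - 24"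
proof (induction x rule: less_induct)
  case (less x)
  \<comment> \<open>Here M is a common multiple of 1, ..., n below 2^k, and y a lower bound for x -
    29/5. The values of M used are lcm(1..12) and lcm(1..18).\<close>
  have base: "psi x \<le> 11056/10000 * real x + 18 * ln (real x - 29/5) - 24"
    if "x \<le> n" "list_all (\<lambda>d. d dvd M) [2..<Suc n]" "0 < M" "M \<le> 2 ^ k" "0 < y" "y + 29/5 \<le> real x"
      "real k * (69315/100000) \<le> 11056/10000 * (y + 29/5) + 18 * ln y - 24" for n M k :: nat and y :: real
  proof -
    have "psi x \<le> psi n" using that(1) by (rule psi_mono)
    also have "\<dots> \<le> ln (real M)"
    proof (rule psi_le_ln[OF that(3)])
      fix d assume "d \<in> {1..n}"
      thus "d dvd M" using that(2) by (cases "d = 1") (auto simp: list_all_iff)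
    qed
    also have "\<dots> \<le> ln (2 ^ k)" using that by (subst ln_le_cancel_iff) (auto simp flip: of_nat_le_iff)
    also have "\<dots> = real k * ln 2" by (simp add: ln_realpow)
    also have "\<dots> \<le> real k * (69315/100000)" using ln_2_bounds by (intro mult_left_mono) auto
    also have "ln y \<le> ln (real x - 29/5)" using that by (subst ln_le_cancel_iff) auto
    ultimately show ?thesis using that(6,7) unfolding ring_distribs add_divide_distrib by linarith
  qed
  have ln: "ln (4::real) = 2 * ln 2" "ln (6::real) = ln 2 + ln 3" "ln (12::real) = 2 * ln 2 + ln 3"
    using ln_realpow[of 2 2] ln_mult[of 2 3] ln_mult[of 4 3] by simp_all
  consider "x \<le> 12" | "13 \<le> x" "x \<le> 18" | "19 \<le> x" "x \<le> 30" | "30 < x" by linarith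
  thus ?case
  proof cases
    case 1
    thus ?thesis using less.prems ln ln_2_bounds
      by (intro base[of 12 27720 15 4]) simp_all
  next
    case 2
    thus ?thesis using ln ln_2_bounds ln_3_bounds
      by (intro base[of 18 12252240 24 6]) simp_all
  next
    case 3
    \<comment> \<open>For m = 1 the recursion leads to 5 < 10, outside the induction hypothesis, so
      \<open>psi 5\<close> is bounded through lcm(1..5) = 60.\<close>
    have "psi 5 \<le> ln 60"
    proof -
      have "d dvd 60" if "d \<in> {1..5}" for d :: nat
      proof -
        have "d \<in> {1, 2, 3, 4, 5}" using that by auto
        thus ?thesis by auto
      qed
      thus ?thesis using psi_le_ln[of 60 5] by simp
    qed
    also have "\<dots> = 2 * ln 2 + ln 3 + ln 5"
      using ln(3) ln_mult[of 12 5] by simp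
    finally have "psi 30 \<le> 2764/100 + 5"
      using psi_le_chebyshev_log[of 1] chebyshev_log_upper[of 1] ln_2_bounds ln_3_bounds ln_5_bounds
      by simp
    moreover have "psi x \<le> psi 30" using 3 by (intro psi_mono)
    moreover have "ln 12 \<le> ln (real x - 29/5)" using 3 by (subst ln_le_cancel_iff) auto
    moreover have "19 \<le> real x" using 3 by simp
    ultimately show ?thesis using ln(3) ln_2_bounds ln_3_bounds by linarith
  next
    case 4
    define m where "m = (x + 29) div 30"
    have m: "x \<le> 30 * m" "30 * m \<le> x + 29" "2 \<le> m" using 4 by (auto simp: m_def)
    have IH: "psi (5 * m) \<le> 11056/10000 * real (5 * m) + 18 * ln (real (5 * m) - 29/5) - 24"
      using m 4 by (intro less.IH) auto
    have "ln (real (5 * m) - 29/5) \<le> ln ((real x - 29/5) / 6)"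
    proof (subst ln_le_cancel_iff)
      have "real (30 * m) \<le> real (x + 29)" using m(2) by (simp only: of_nat_le_iff)
      thus "real (5 * m) - 29/5 \<le> (real x - 29/5) / 6" by simp
    next
      have "2 \<le> real m" using m(3) by simp
      thus "0 < real (5 * m) - 29/5" by simp
    qed (use 4 in auto)
    also have "\<dots> = ln (real x - 29/5) - (ln 2 + ln 3)" using 4 ln(2) by (subst ln_div) auto
    finally have ln_le: "ln (real (5 * m) - 29/5) \<le> ln (real x - 29/5) - (ln 2 + ln 3)" .
    have "psi x \<le> psi (30 * m)" using m(1) by (rule psi_mono)
    also have "\<dots> \<le> psi (5 * m) + 2764/100 * real m"
      using psi_le_chebyshev_log[of m] chebyshev_log_upper[of m] by linarith
    \<comment> \<open>The slope is the fixed point of the recursion: 5 * 1.1056 + 27.64 = 30 *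
      1.1056.\<close>
    also have "\<dots> \<le> 11056/10000 * (real x + 29) + 18 * ln (real (5 * m) - 29/5) - 24"
    proof -
      have "30 * real m \<le> real x + 29"
        using m(2) by (simp flip: of_nat_le_iff)
      thus ?thesis
        using IH unfolding ring_distribs of_nat_mult of_nat_numeral by linarith
    qed
    finally show ?thesis
      using ln_le ln_2_bounds ln_3_bounds unfolding ring_distribs by linarith
  qed
qed

text \<open>The tangent at 2^k lies above the concave logarithm.\<close>

lemma ln_le_tangent: "0 < x \<Longrightarrow> ln (x :: real) \<le> x / 2 ^ k - 1 + real k * ln 2"
  using ln_add_one_self_le_self2[of "x / 2 ^ k - 1"] by (simp add: ln_div ln_realpow)

lemma psi_upper: "psi x \<le> 111/100 * real x + 108"
proof (cases "10 \<le> x")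
  case True
  have "ln (real x - 29/5) \<le> ln (real x)" using True by (subst ln_le_cancel_iff) auto
  \<comment> \<open>With k = 12 the logarithm adds 18 / 4096 < 0.0044 to the slope, giving 1.11, and
    keeps the constant below 108.\<close>
  also have "\<dots> \<le> real x / 2 ^ 12 - 1 + real 12 * ln 2" using True by (intro ln_le_tangent) auto
  finally show ?thesis using psi_upper_log[OF True] ln_2_bounds by simp
next
  case False
  hence "psi x \<le> psi 10" by (intro psi_mono) auto
  also have "\<dots> \<le> 11056/10000 * 10 + 18 * ln (21/5) - 24" using psi_upper_log[of 10] by simp
  also have "ln (21/5 :: real) \<le> 21/5 - 1" using ln_le_tangent[of "21/5" 0] by simp
  finally show ?thesis by simp
qed

lemma psi_lower_30:
  "m > 0 \<Longrightarrow> 27638/1000 * real m - ln (30 * real m) / 2 - 3/2 \<le> psi (30 * m)"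
  using chebyshev_log_lower[of m] chebyshev_log_le_psi[of m] by linarith

lemma psi_lower:
  assumes "30 \<le> x"
  shows "27638/30000 * (real x - 29) - ln (real x) / 2 - 3/2 \<le> psi x"
proof -
  define m where "m = x div 30"
  have m: "30 * m \<le> x" "x \<le> 30 * m + 29" "0 < m" using assms by (auto simp: m_def)
  have "real x \<le> 30 * real m + 29" using m(2) by (simp flip: of_nat_le_iff)
  moreover have "30 * real m \<le> real x" using m(1) by (simp flip: of_nat_le_iff)
  hence "ln (30 * real m) \<le> ln (real x)" using m(3) by (subst ln_le_cancel_iff) auto
  moreover have "psi (30 * m) \<le> psi x" using m(1) by (rule psi_mono)
  ultimately show ?thesis using psi_lower_30[OF m(3)]
    unfolding ring_distribs add_divide_distrib by linarith
qed

section \<open>From \<open>psi\<close> to prime counts\<close>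

text \<open>The interval \<open>(x, 2x]\<close> contains at most one power of each prime.\<close>
lemma psi_doubling:
  assumes s: "\<And>q. q * q \<le> 2 * x \<Longrightarrow> q \<le> s"
  shows "psi (2 * x) - psi x \<le> (real (prime_count (2 * x)) - real (prime_count x)) * ln (2 * real x) + psi s"
proof -
  define I where "I = {x<..2*x}"
  define P where "P = {d \<in> I. prime d}"
  define Q where "Q = {d \<in> I. primepow d \<and> \<not> prime d}"
  have fin: "finite I" "finite P" "finite Q" by (auto simp: I_def P_def Q_def)
  have "psi (2 * x) - psi x = (\<Sum>d\<in>I. mangoldt d)"
    unfolding I_def by (rule psi_diff) simp
  also have "\<dots> = (\<Sum>d\<in>P \<union> Q. mangoldt d)"
    using fin by (intro sum.mono_neutral_right) (auto simp: P_def Q_def mangoldt_def)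
  also have "\<dots> = (\<Sum>d\<in>P. mangoldt d) + (\<Sum>d\<in>Q. mangoldt d)"
    using fin by (intro sum.union_disjoint) (auto simp: P_def Q_def)
  also have "(\<Sum>d\<in>P. mangoldt d) \<le> (\<Sum>d\<in>P. ln (2 * real x))"
  proof (rule sum_mono)
    fix d assume "d \<in> P"
    hence "prime d" "d \<le> 2 * x" by (auto simp: P_def I_def)
    moreover from this have "real d \<le> 2 * real x" by (simp flip: of_nat_le_iff)
    ultimately show "mangoldt d \<le> ln (2 * real x)" using prime_gt_0_nat[of d] by simp
  qed
  also have "\<dots> = (real (prime_count (2 * x)) - real (prime_count x)) * ln (2 * real x)"
  proof -
    have "P = {p. prime p \<and> p \<le> 2 * x} - {p. prime p \<and> p \<le> x}"
      by (auto simp: P_def I_def)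
    hence "card P = prime_count (2 * x) - prime_count x"
      unfolding prime_count_def by (simp add: card_Diff_subset Collect_mono_iff)
    thus ?thesis using prime_count_mono[of x "2 * x"] by simp
  qed
  also have "(\<Sum>d\<in>Q. mangoldt d) = (\<Sum>q\<in>aprimedivisor ` Q. ln (real q))"
  proof -
    have "inj_on aprimedivisor Q"
    proof (rule inj_onI)
      fix d e assume d: "d \<in> Q" and e: "e \<in> Q" and eq: "aprimedivisor d = aprimedivisor e"
      obtain p i where pi: "prime p" "d = p ^ i" "0 < i"
        using d by (auto simp: Q_def primepow_def)
      obtain q j where qj: "prime q" "e = q ^ j" "0 < j"
        using e by (auto simp: Q_def primepow_def)
      have pq: "q = p" using eq pi qj by (simp add: aprimedivisor_prime_power)
      have p2: "2 \<le> p" using pi(1) by (rule prime_ge_2_nat)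
      have le: "p ^ b \<ge> 2 * p ^ a" if "a < b" for a b
      proof -
        have "p ^ b \<ge> p ^ Suc a" using that p2 by (intro power_increasing) auto
        moreover have "p ^ Suc a \<ge> 2 * p ^ a" using p2 by simp
        ultimately show ?thesis by linarith
      qed
      have "x < p ^ i" "p ^ i \<le> 2 * x" "x < p ^ j" "p ^ j \<le> 2 * x"
        using d e pi qj pq by (auto simp: Q_def I_def)
      hence "i = j" using le[of i j] le[of j i] by (cases i j rule: linorder_cases) linarith+
      thus "d = e" using pi qj pq by simp
    qed
    thus ?thesis by (subst sum.reindex) (auto simp: Q_def mangoldt_def intro!: sum.cong)
  qed
  \<comment> \<open>The base q of a proper power in (x, 2x] has q * q \<le> 2x, hence q \<le> s, so
    these logarithms are terms of \<open>psi s\<close>.\<close>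
  also have "\<dots> = (\<Sum>q\<in>aprimedivisor ` Q. mangoldt q)"
    by (intro sum.cong) (auto simp: Q_def primepow_def aprimedivisor_prime_power)
  also have "\<dots> \<le> psi s"
    unfolding psi_def
  proof (rule sum_mono2)
    show "aprimedivisor ` Q \<subseteq> {1..s}"
    proof
      fix p assume "p \<in> aprimedivisor ` Q"
      then obtain q i where q: "q ^ i \<in> I" "prime q" "0 < i" "\<not> prime (q ^ i)" "p = aprimedivisor (q ^ i)"
        by (auto simp: Q_def primepow_def)
      have "p = q" using q by (simp add: aprimedivisor_prime_power)
      have "i \<noteq> 1" using q by auto
      hence "q ^ 2 \<le> q ^ i" using q(2,3) prime_gt_0_nat[of q] by (intro power_increasing) auto
      hence "q * q \<le> 2 * x" using q(1) by (auto simp: I_def power2_eq_square)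
      thus "p \<in> {1..s}" using s[of q] \<open>p = q\<close> prime_gt_0_nat[OF q(2)] by auto
    qed
  qed (auto intro: mangoldt_nonneg)
  finally show ?thesis by simp
qed

lemma ln_540: "ln (540::real) = 2 * ln 2 + 3 * ln 3 + ln 5"
proof -
  have "(540::real) = 2 ^ 2 * 3 ^ 3 * 5" by simp
  hence "ln (540::real) = ln (2 ^ 2 * 3 ^ 3 * 5)" by (rule arg_cong)
  thus ?thesis by (simp add: ln_mult ln_realpow del: power_numeral power_one_right)
qed

text \<open>
  The derivative \<open>1 / (u - 5/4) - 1 / (u - 5/4)\<^sup>2\<close>, where \<open>u = ln t\<close>, exceeds \<open>1 / u\<close> for \<open>u \<ge> 25/4\<close>. So
  the increments of this function dominate the terms that arise from partial summation.
\<close>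
definition legendre_approx :: "real \<Rightarrow> real" where
  "legendre_approx t = t / (ln t - 5/4)"

lemma legendre_approx_increment:
  assumes "540 \<le> t"
  shows "1 / ln (t + 1) \<le> legendre_approx (t + 1) - legendre_approx t"
proof -
  \<comment> \<open>540 is just above e^(25/4), about 518, the point from which the derivative
    dominates.\<close>
  have ln_ge: "629/100 \<le> ln z" if "540 \<le> z" for z :: real
  proof -
    have "629/100 \<le> ln (540::real)" using ln_540 ln_2_bounds ln_3_bounds ln_5_bounds by linarith
    also have "\<dots> \<le> ln z" using that by (subst ln_le_cancel_iff) auto
    finally show ?thesis .
  qed
  have "\<exists>z. t < z \<and> z < t + 1 \<and> legendre_approx (t + 1) - legendre_approx t =
      (t + 1 - t) * ((ln z - 9/4) / (ln z - 5/4)\<^sup>2)"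
  proof (rule MVT2)
    fix z assume "t \<le> z" "z \<le> t + 1"
    hence z: "540 \<le> z" using assms by simp
    hence "(legendre_approx has_real_derivative (1 * (ln z - 5/4) - z * (1 / z)) / ((ln z - 5/4) * (ln z - 5/4))) (at z)"
      using ln_ge[of z] unfolding legendre_approx_def by (auto intro!: derivative_eq_intros)
    thus "(legendre_approx has_real_derivative (ln z - 9/4) / (ln z - 5/4)\<^sup>2) (at z)"
      using z by (simp add: power2_eq_square)
  qed simp
  then obtain z where z: "t < z" "z < t + 1"
    and eq: "legendre_approx (t + 1) - legendre_approx t = (ln z - 9/4) / (ln z - 5/4)\<^sup>2" by auto
  define u where "u = ln z"
  have u: "629/100 \<le> u" using ln_ge[of z] z assms by (simp add: u_def)
  have "1 / ln (t + 1) \<le> 1 / u"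
    using u z assms unfolding u_def by (intro divide_left_mono) auto
  also have "1 / u \<le> (u - 9/4) / (u - 5/4)\<^sup>2"
    using u by (simp add: divide_simps power2_eq_square) (simp add: algebra_simps)
  finally show ?thesis unfolding eq u_def .
qed

text \<open>Partial summation as an induction. In the step, \<open>psi_upper\<close> bounds the Abel
  term psi n * (1/l - 1/l'); its part n * (1/l - 1/l') telescopes up to 1/l', which the increment of
  \<open>legendre_approx\<close> absorbs.\<close>

lemma prime_count_upper_aux:
  assumes "540 \<le> n"
  shows "real (prime_count n) \<le> psi n / ln (real n)
    + 111/100 * (legendre_approx (real n) - real n / ln (real n)) + 108 * (1 / ln 540 - 1 / ln (real n))"
  using assms
proof (induction n rule: dec_induct)
  case base
  \<comment> \<open>540 is a multiple of 30, so \<open>psi_lower_30\<close> applies without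
    rounding. The right-hand side is at least 78 + 1.11 * 19 = 99.09, while \<pi>(540) = 99.\<close>
  define l where "l = ln (540::real)"
  have l: "6291/1000 \<le> l" "l \<le> 6292/1000"
    using ln_540 ln_2_bounds ln_3_bounds ln_5_bounds unfolding l_def by linarith+
  have "27638/1000 * 18 - l / 2 - 3/2 \<le> psi 540"
    using psi_lower_30[of 18] by (simp add: l_def)
  hence "492 \<le> psi 540" using l by linarith
  hence "78 \<le> psi 540 / l" using l by (simp add: field_simps)
  moreover have "19 \<le> 540 / (l - 5/4) - 540 / l"
  proof -
    have "(l - 5/4) * l \<le> (6292/1000 - 5/4) * (6292/1000)" using l by (intro mult_mono) auto
    moreover have "0 < (l - 5/4) * l" using l by simp
    ultimately show ?thesis using l by (simp add: field_simps)
  qed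
  ultimately have "99 \<le> psi 540 / l + 111/100 * (540 / (l - 5/4) - 540 / l)"
    unfolding ring_distribs by linarith
  thus ?case by (simp add: prime_count_values legendre_approx_def l_def)
next
  case (step n)
  define l l' where "l = ln (real n)" and "l' = ln (real n + 1)"
  have pos: "0 < l" "l \<le> l'" using step.hyps by (auto simp: l_def l'_def)
  have "real (prime_count (Suc n)) \<le> real (prime_count n) + mangoldt (Suc n) / l'"
  proof (cases "prime (Suc n)")
    case True
    thus ?thesis using pos step.hyps by (simp add: prime_count_Suc l'_def add_ac)
  next
    case False
    thus ?thesis using pos by (simp add: prime_count_Suc mangoldt_nonneg)
  qed
  moreover have "psi n * (1 / l - 1 / l') \<le> (111/100 * real n + 108) * (1 / l - 1 / l')"
    using pos by (intro mult_right_mono psi_upper) (simp add: field_simps)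
  moreover have "1 / l' \<le> legendre_approx (real n + 1) - legendre_approx (real n)"
    unfolding l'_def using step.hyps by (intro legendre_approx_increment) simp
  moreover have "real (prime_count n) \<le> psi n * (1 / l)
      + 111/100 * (legendre_approx (real n) - real n * (1 / l)) + 108 * (1 / ln 540 - 1 / l)"
    using step.IH by (simp add: l_def)
  moreover define a a' where "a = 1 / l" and "a' = 1 / l'"
  ultimately have "real (prime_count (Suc n)) \<le> (psi n + mangoldt (Suc n)) * a'
      + 111/100 * (legendre_approx (real n + 1) - (real n + 1) * a') + 108 * (1 / ln 540 - a')"
    unfolding a_def[symmetric] a'_def[symmetric] divide_inverse[of "mangoldt (Suc n)"]
      inverse_eq_divide[of l'] ring_distribs by linarith
  thus ?case by (simp add: psi_Suc a'_def l'_def add_ac)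
qed

text \<open>Inserting \<open>psi_upper\<close> cancels both terms that are subtracted in the
  auxiliary bound.\<close>

lemma prime_count_upper:
  assumes "540 \<le> n"
  shows "real (prime_count n) \<le> 111/100 * real n / (ln (real n) - 5/4) + 108 / ln 540"
proof -
  have "psi n / ln (real n) \<le> (111/100 * real n + 108) / ln (real n)"
    using assms by (intro divide_right_mono psi_upper) auto
  thus ?thesis
    using prime_count_upper_aux[OF assms] by (simp add: legendre_approx_def algebra_simps add_divide_distrib)
qed

text \<open>The claim is \<pi>(x) \<le> 2 (\<pi>(2x) - \<pi>(x)). After multiplication by ln (2x)
  the left side is at most 1.373 x + 163 and the right side at least 1.4516 x - 684.\<close>

lemma prime_count_doubling_large:
  assumes "14000 \<le> x"
  shows "3 * prime_count x \<le> 2 * prime_count (2 * x)"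
proof -
  define X L where "X = real x" and "L = ln X"
  have X: "14000 \<le> X" using assms by (simp add: X_def)
  have ln2x: "ln (2 * X) = L + ln 2" using X by (simp add: L_def ln_mult)
  have L_upper: "L \<le> X / 16384 + 871/100"
    using ln_le_tangent[of X 14] X ln_2_bounds by (simp add: L_def)
  have L_lower: "953/100 \<le> L"
  proof -
    \<comment> \<open>2^9 * 3^3 = 13824 is a smooth number just below 14000.\<close>
    have "953/100 \<le> 9 * ln 2 + 3 * ln (3::real)" using ln_2_bounds ln_3_bounds by linarith
    also have "\<dots> = ln (2 ^ 9 * 3 ^ 3)" by (simp only: ln_mult ln_realpow) simp
    also have "\<dots> \<le> L" using X unfolding L_def by (subst ln_le_cancel_iff) auto
    finally show ?thesis .
  qed
  define s where "s = nat \<lfloor>sqrt (2 * X)\<rfloor>"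
  have "real s \<le> sqrt (2 * X)" using X by (simp add: s_def)
  \<comment> \<open>Tangent bound for the square root, nearly sharp at X = 14000, where sqrt (2 X)
    is about 167.3.\<close>
  also have "\<dots> \<le> X / 167 + 167 / 2"
  proof -
    have "0 \<le> (sqrt (2 * X) - 167)\<^sup>2" by simp
    also have "\<dots> = 2 * X - 2 * 167 * sqrt (2 * X) + 167 ^ 2" using X by (simp add: power2_diff)
    finally show ?thesis by simp
  qed
  finally have s: "real s \<le> X / 167 + 167 / 2" .
  have "q \<le> s" if "q * q \<le> 2 * x" for q
  proof -
    have "real q * real q \<le> 2 * X"
      using that unfolding X_def by (metis of_nat_le_iff of_nat_mult of_nat_numeral)
    hence "real q \<le> sqrt (2 * X)" by (intro real_le_rsqrt) (simp add: power2_eq_square)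
    thus ?thesis by (simp add: s_def le_nat_floor)
  qed
  hence "psi (2 * x) - psi x \<le> (real (prime_count (2 * x)) - real (prime_count x)) * (L + ln 2) + psi s"
    using psi_doubling[of x s] ln2x by (simp add: X_def)
  moreover have "27638/30000 * (2 * X - 29) - (L + ln 2) / 2 - 3/2 \<le> psi (2 * x)"
    using psi_lower[of "2 * x"] assms ln2x by (simp add: X_def)
  moreover have "psi x \<le> 111/100 * X + 108" "psi s \<le> 111/100 * real s + 108"
    using psi_upper by (simp_all add: X_def)
  ultimately have diff: "7258/10000 * X - 342
      \<le> (real (prime_count (2 * x)) - real (prime_count x)) * (L + ln 2)"
    using s X L_upper ln_2_bounds unfolding ring_distribs add_divide_distrib by linarith
  have "real (prime_count x) \<le> 111/100 * X / (L - 5/4) + 108 / ln 540"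
    using prime_count_upper[of x] assms by (simp add: X_def L_def)
  also have "108 / ln 540 \<le> (1718/100 :: real)"
    using ln_540 ln_2_bounds ln_3_bounds ln_5_bounds by (subst pos_divide_le_eq) auto
  finally have "real (prime_count x) * (L + ln 2)
      \<le> (111/100 * X / (L - 5/4) + 1718/100) * (L + ln 2)"
    using L_lower by (intro mult_right_mono) auto
  also have "\<dots> = 111/100 * X * ((L + ln 2) / (L - 5/4)) + 1718/100 * (L + ln 2)"
    by (simp add: algebra_simps add_divide_distrib)
  finally have "real (prime_count x) * (L + ln 2)
      \<le> 111/100 * X * ((L + ln 2) / (L - 5/4)) + 1718/100 * (L + ln 2)" .
  \<comment> \<open>The ratio decreases in L and is about 1.2347 at L = 9.53.\<close>
  moreover have "(L + ln 2) / (L - 5/4) \<le> 1235/1000"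
    using L_lower ln_2_bounds by (simp add: field_simps)
  hence "111/100 * X * ((L + ln 2) / (L - 5/4)) \<le> 111/100 * X * (1235/1000)"
    using X by (intro mult_left_mono) auto
  ultimately have "real (prime_count x) * (L + ln 2) \<le> 1373/1000 * X + 163"
    using X L_upper ln_2_bounds unfolding ring_distribs by linarith
  with diff X have "real (prime_count x) * (L + ln 2)
      \<le> 2 * ((real (prime_count (2 * x)) - real (prime_count x)) * (L + ln 2))"
    by linarith
  hence "(3 * real (prime_count x)) * (L + ln 2) \<le> (2 * real (prime_count (2 * x))) * (L + ln 2)"
    by (simp add: algebra_simps)
  hence "3 * real (prime_count x) \<le> 2 * real (prime_count (2 * x))"
    using L_lower ln_2_bounds by (subst (asm) mult_le_cancel_right) auto
  thus ?thesis by linarith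
qed

subsection \<open>The doubling inequality and the prime enumeration\<close>

text \<open>Evenness excludes x = 5, where \<pi>(5) = 3 and \<pi>(10) = 4 violate the
  inequality.\<close>

lemma prime_count_doubling:
  assumes "even (prime_count x)"
  shows "3 * prime_count x \<le> 2 * prime_count (2 * x)"
proof -
  consider "x \<le> 1" | "x = 2" | "x = 3" | "x = 4" | "x = 5" | "x = 6" | "7 \<le> x" "x \<le> 14000" | "14000 \<le> x"
    by linarith
  thus ?thesis
  proof cases
    case 1
    hence "prime_count x = 0" by (auto simp: prime_count_def dest: prime_ge_2_nat)
    thus ?thesis by simp
  next
    case 2
    thus ?thesis using assms by (simp add: prime_count_2)
  next
    case 3
    have "prime_count 3 \<le> 2"
      using prime_count_mono[of 3 4] prime_count_values by simp
    thus ?thesis using 3 prime_count_values by simp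
  next
    case 4
    thus ?thesis using prime_count_values by simp
  next
    case 5
    \<comment> \<open>The table has only even arguments, so \<pi>(5) is bracketed by its values at 4
      and 6; parity then rules out 3.\<close>
    have "prime_count 5 \<le> 3" "2 \<le> prime_count 5"
      using prime_count_mono[of 5 6] prime_count_mono[of 4 5] prime_count_values by simp_all
    hence "prime_count 5 = 2" using 5 assms by (cases "prime_count 5 = 3") auto
    thus ?thesis using 5 prime_count_values by simp
  next
    case 6
    thus ?thesis using assms prime_count_values by simp
  next
    case 7
    thus ?thesis by (rule prime_count_doubling_table)
  next
    case 8
    thus ?thesis by (rule prime_count_doubling_large)
  qed
qed

lemma primes_pi_of_nat: "primes_pi (real n) = prime_count n"
  by (simp add: primes_pi_def prime_count_def)

lemma prime_nth_prime: "prime (nth_prime k)"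
  using enumerate_in_set[OF primes_infinite, of "k - 1"] by (simp add: nth_prime_def)

lemma prime_count_nth_prime:
  assumes "k \<ge> 1"
  shows "prime_count (nth_prime k) = k"
proof -
  let ?P = "{p :: nat. prime p}"
  have "{p. prime p \<and> p \<le> nth_prime k} = enumerate ?P ` {..<k}"
  proof (intro equalityI subsetI)
    fix p assume p: "p \<in> {p. prime p \<and> p \<le> nth_prime k}"
    then obtain i where i: "p = enumerate ?P i" using enumerate_Ex[of ?P p] primes_infinite by auto
    hence "i \<le> k - 1" using p primes_infinite by (auto simp: nth_prime_def)
    thus "p \<in> enumerate ?P ` {..<k}" using i assms by auto
  next
    fix p assume "p \<in> enumerate ?P ` {..<k}"
    then obtain i where i: "p = enumerate ?P i" "i < k" by auto
    hence "enumerate ?P i \<le> enumerate ?P (k - 1)" using primes_infinite by auto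
    thus "p \<in> {p. prime p \<and> p \<le> nth_prime k}"
      using i enumerate_in_set[OF primes_infinite, of i] by (simp add: nth_prime_def)
  qed
  moreover have "inj_on (enumerate ?P) {..<k}"
    using inj_on_subset[OF inj_enumerate[OF primes_infinite] subset_UNIV] .
  ultimately show ?thesis by (simp add: prime_count_def card_image)
qed

theorem theorem4:
  fixes n :: nat
  assumes "n \<ge> 1"
  shows "int (primes_pi (real (nth_prime (3 * n)))) - int (primes_pi (real (nth_prime (3 * n)) / 2)) > int n"
proof -
  define p q where "p = nth_prime (3 * n)" and "q = nth_prime (2 * n)"
  have p: "prime_count p = 3 * n" "prime p" and q: "prime_count q = 2 * n" "prime q"
    using assms by (simp_all add: p_def q_def prime_count_nth_prime prime_nth_prime)
  have "p < 2 * q"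
  proof (rule ccontr)
    assume "\<not> p < 2 * q"
    moreover have "p \<noteq> 2 * q" using p(2) q(2) prime_product[of 2 q] by auto
    ultimately have "2 * q < p" by simp
    \<comment> \<open>This gives \<pi>(2q) < 3n, whereas doubling at q, with \<pi>(q) = 2n even,
      gives \<pi>(2q) \<ge> 3n.\<close>
    hence "prime_count (2 * q) \<le> prime_count (p - 1)" by (intro prime_count_mono) auto
    also have "\<dots> < prime_count p" using prime_count_Suc[of "p - 1"] p(2) prime_gt_0_nat[of p] by simp
    finally show False using prime_count_doubling[of q] p(1) q(1) by simp
  qed
  \<comment> \<open>Primes up to p/2 are smaller than q, so there are fewer than 2n of them.\<close>
  have "primes_pi (real p / 2) \<le> prime_count (q - 1)"
    unfolding primes_pi_def prime_count_def using \<open>p < 2 * q\<close> by (intro card_mono) auto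
  also have "\<dots> < prime_count q" using prime_count_Suc[of "q - 1"] q(2) prime_gt_0_nat[of q] by simp
  finally show ?thesis using p(1) q(1) by (simp add: primes_pi_of_nat flip: p_def)
qed

end
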